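(* For all integers $m\geq 3$, $n\geq m+1$, $d\geq 1$ there exists a prime integral point set $M$ of $n$ points in $\mathbb{R}^m$ which contains points $M_1,M_2$ with $|M_1M_2|=d$.
   Context: An integral point set in $\mathbb{R}^m$ is a finite set $M\subset\mathbb{R}^m$ such that all pairwise Euclidean distances between points of $M$ are integers and $M$ is not contained in any $(m-1)$-dimensional affine hyperplane. An integral point set is prime if the greatest common divisor of all distances occurring between its points is $1$. *)

theory Defs
  imports "HOL-Analysis.Analysis"
begin

definition integral_point_set :: "'a::euclidean_space set \<Rightarrow> bool" where
  "integral_point_set M \<longleftrightarrow>
     finite M \<and>
     (\<forall>x\<in>M. \<forall>y\<in>M. dist x y \<in> \<int>) \<and>
     \<not> (\<exists>H. affine H \<and> aff_dim H = int DIM('a) - 1 \<and> M \<subseteq> H)"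

definition distances :: "'a::metric_space set \<Rightarrow> real set" where
  "distances M = {dist x y |x y. x \<in> M \<and> y \<in> M \<and> x \<noteq> y}"

(* For an integral point set every distance is of the form real k, so the set
   below is exactly the set of distances, read as natural numbers. *)
definition prime_integral_point_set :: "'a::euclidean_space set \<Rightarrow> bool" where
  "prime_integral_point_set M \<longleftrightarrow>
     integral_point_set M \<and> Gcd {k::nat. real k \<in> distances M} = 1"

end

theory Submission
  imports Defs
begin

text \<open>
  Fix a coordinate axis and a regular simplex with \<open>m - 1\<close> vertices and edge length \<open>d\<close>, placed
  in the orthogonal complement of the axis so that all its vertices have norm \<open>r = 3 ^ K > d\<close>.
  A point with coordinate \<open>t\<close> on the axis is at distance \<open>sqrt (t\<^sup>2 + r\<^sup>2)\<close> from every vertex,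
  so each factorisation \<open>9 ^ K = 3 ^ i * 3 ^ (2 * K - i)\<close> yields a usable point: the Pythagorean
  triple with legs \<open>t = (3 ^ (2 * K - i) - 3 ^ i) / 2\<close> and \<open>r\<close>. For \<open>i = K\<close> and \<open>i = 0\<close> the
  hypotenuses are \<open>3 ^ K\<close> and \<open>(9 ^ K + 1) / 2\<close>, which are coprime.
\<close>

definition leg :: "nat \<Rightarrow> nat \<Rightarrow> real" where
  "leg K i = (3 ^ (2 * K - i) - 3 ^ i) / 2"

text \<open>Both powers of 3 are odd, so the division by 2 is exact. The value is a natural number,
  ready for \<open>coprime\<close> and \<open>Gcd\<close>.\<close>

definition hypot :: "nat \<Rightarrow> nat \<Rightarrow> nat" where
  "hypot K i = (3 ^ (2 * K - i) + 3 ^ i) div 2"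

lemma real_hypot: "real (hypot K i) = (3 ^ (2 * K - i) + 3 ^ i) / 2"
  unfolding hypot_def by (subst real_of_nat_div) auto

text \<open>Makes the leg an integer without a second parity argument.\<close>

lemma leg_eq_hypot_diff: "leg K i = real (hypot K i) - 3 ^ i"
  by (simp add: leg_def real_hypot field_simps)

lemma leg_in_Ints: "leg K i \<in> \<int>"
  unfolding leg_eq_hypot_diff by (intro Ints_diff Ints_power) auto

lemma leg_self [simp]: "leg K K = 0"
  by (simp add: leg_def mult_2)

lemma leg_pythagoras:
  assumes "i \<le> K"
  shows "(leg K i)\<^sup>2 + (3 ^ K)\<^sup>2 = (real (hypot K i))\<^sup>2"
proof -
  have "(3::real) ^ (2 * K - i) * 3 ^ i = (3 ^ K)\<^sup>2"
    using assms by (simp flip: power_add power_mult add: mult.commute)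
  then show ?thesis
    by (simp add: leg_def real_hypot power2_eq_square field_simps)
qed

lemma leg_strict_antimono:
  assumes "i < j" "j \<le> K"
  shows "leg K j < leg K i"
proof -
  have "(3::real) ^ i < 3 ^ j" "(3::real) ^ (2 * K - j) < 3 ^ (2 * K - i)"
    using assms by (auto intro!: power_strict_increasing)
  then show ?thesis
    unfolding leg_def by (intro divide_strict_right_mono diff_strict_mono) auto
qed

lemma inj_on_leg: "inj_on (leg K) {..K}"
proof (rule linorder_inj_onI)
  show "leg K i \<noteq> leg K j" if "i < j" "i \<in> {..K}" "j \<in> {..K}" for i j
    using leg_strict_antimono[of i j K] that by auto
qed auto

text \<open>Twice the second number is \<open>3 ^ K * 3 ^ K + 1\<close>, the successor of a multiple
  of the first.\<close>

lemma coprime_hypot: "coprime (hypot K K) (hypot K 0)"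
proof -
  have 1: "hypot K K = 3 ^ K" by (simp add: hypot_def mult_2)
  have "real (2 * hypot K 0) = real (3 ^ K * 3 ^ K + 1)"
    by (simp add: real_hypot mult_2 power_add)
  then have "2 * hypot K 0 = 3 ^ K * 3 ^ K + 1" by (simp only: of_nat_eq_iff)
  then have "coprime ((3::nat) ^ K) (2 * hypot K 0)"
    by (metis Suc_eq_plus1 coprime_Suc_right_nat coprime_mult_left_iff)
  then show ?thesis unfolding 1 by (metis coprime_mult_right_iff)
qed

text \<open>The left-hand side is the squared norm of a simplex vertex when \<open>N\<close> is the
  number of vertices. As a quadratic in \<beta> it has quarter discriminant \<open>D\<close>, and
  \<alpha> \<le> r makes the larger root nonnegative.\<close>

lemma exists_scaled_diagonal:
  fixes \<alpha> r N :: real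
  assumes "0 \<le> \<alpha>" "\<alpha> \<le> r" "N > 0"
  obtains \<beta> where "\<beta> \<ge> 0" "\<alpha>\<^sup>2 + 2 * \<alpha> * \<beta> + N * \<beta>\<^sup>2 = r\<^sup>2"
proof -
  define D where "D = \<alpha>\<^sup>2 + N * (r\<^sup>2 - \<alpha>\<^sup>2)"
  have D: "D \<ge> \<alpha>\<^sup>2"
    unfolding D_def using assms by (simp add: power_mono)
  define \<beta> where "\<beta> = (sqrt D - \<alpha>) / N"
  have 0: "\<beta> \<ge> 0" unfolding \<beta>_def using assms D by (simp add: real_le_rsqrt)
  have "N * \<beta> = sqrt D - \<alpha>" using assms by (simp add: \<beta>_def)
  have "N * (\<alpha>\<^sup>2 + 2 * \<alpha> * \<beta> + N * \<beta>\<^sup>2) = N * \<alpha>\<^sup>2 + 2 * \<alpha> * (N * \<beta>) + (N * \<beta>)\<^sup>2"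
    by (simp add: algebra_simps power2_eq_square)
  also have "\<dots> = N * \<alpha>\<^sup>2 + (sqrt D)\<^sup>2 - \<alpha>\<^sup>2"
    unfolding \<open>N * \<beta> = _\<close> by (simp add: algebra_simps power2_eq_square)
  also have "\<dots> = N * r\<^sup>2"
    using D order_trans[OF zero_le_power2 D] by (simp add: D_def algebra_simps)
  finally have "\<alpha>\<^sup>2 + 2 * \<alpha> * \<beta> + N * \<beta>\<^sup>2 = r\<^sup>2"
    using assms(3) by simp
  with 0 show thesis by (rule that)
qed

text \<open>A scaled standard simplex translated along its diagonal: \<alpha> alone fixes the edge
  length, which leaves \<beta> free to adjust the distance of the vertices from the origin.\<close>

definition vertex :: "real \<Rightarrow> real \<Rightarrow> 'a set \<Rightarrow> 'a \<Rightarrow> 'a::euclidean_space" where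
  "vertex \<alpha> \<beta> B b = \<alpha> *\<^sub>R b + \<beta> *\<^sub>R \<Sum>B"

lemma dist_vertex_vertex:
  assumes "b \<in> Basis" "c \<in> Basis" "b \<noteq> c"
  shows "dist (vertex \<alpha> \<beta> B b) (vertex \<alpha> \<beta> B c) = \<bar>\<alpha>\<bar> * sqrt 2"
proof -
  have "vertex \<alpha> \<beta> B b - vertex \<alpha> \<beta> B c = \<alpha> *\<^sub>R (b - c)"
    by (simp add: vertex_def algebra_simps)
  moreover have "norm (b - c) = sqrt 2"
    using assms by (simp add: norm_eq_sqrt_inner inner_diff inner_Basis)
  ultimately show ?thesis by (simp add: dist_norm)
qed

lemma inner_sum_Basis_subset:
  assumes "B \<subseteq> Basis" "b \<in> Basis"
  shows "b \<bullet> \<Sum>B = (if b \<in> B then 1 else 0)"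
proof -
  have "finite B" using assms(1) finite_Basis finite_subset by blast
  have "b \<bullet> \<Sum>B = (\<Sum>c\<in>B. if b = c then 1 else 0)"
    unfolding inner_sum_right using assms by (intro sum.cong) (auto simp: inner_Basis)
  then show ?thesis using \<open>finite B\<close> by simp
qed

lemma norm_vertex:
  assumes "B \<subseteq> Basis" "b \<in> B"
  shows "(norm (vertex \<alpha> \<beta> B b))\<^sup>2 = \<alpha>\<^sup>2 + 2 * \<alpha> * \<beta> + real (card B) * \<beta>\<^sup>2"
proof -
  have "\<Sum>B \<bullet> \<Sum>B = (\<Sum>c\<in>B. c \<bullet> \<Sum>B)" by (rule inner_sum_left)
  also have "\<dots> = (\<Sum>c\<in>B. 1)"
    using assms(1) inner_sum_Basis_subset[OF assms(1)] by (intro sum.cong) auto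
  finally have "\<Sum>B \<bullet> \<Sum>B = card B" by simp
  moreover have "b \<bullet> \<Sum>B = 1" "\<Sum>B \<bullet> b = 1" "b \<bullet> b = 1"
    using assms inner_sum_Basis_subset[of B b] by (auto simp: inner_Basis inner_commute)
  ultimately show ?thesis
    unfolding power2_norm_eq_inner vertex_def inner_add
    by (simp add: power2_eq_square algebra_simps)
qed

lemma dist_axis_vertex:
  assumes "e \<in> Basis" "B \<subseteq> Basis - {e}" "b \<in> B"
  shows "(dist (t *\<^sub>R e) (vertex \<alpha> \<beta> B b))\<^sup>2 = t\<^sup>2 + (norm (vertex \<alpha> \<beta> B b))\<^sup>2"
proof -
  have "b \<in> Basis" "b \<noteq> e" "e \<notin> B" "B \<subseteq> Basis" using assms by auto
  then have "orthogonal (t *\<^sub>R e) (- vertex \<alpha> \<beta> B b)"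
    using assms(1) inner_sum_Basis_subset[of B e]
    by (simp add: orthogonal_def vertex_def inner_diff inner_Basis)
  then show ?thesis
    using assms(1) norm_add_Pythagorean by (fastforce simp: dist_norm)
qed

text \<open>Adding the orthogonality relations over \<open>B\<close> gives a positive multiple of
  \<open>w \<bullet> \<Sum>B\<close>, so this product vanishes and each relation reduces to its
  \<alpha> term. The signs of \<alpha> and \<beta> give the positivity.\<close>

lemma orthogonal_to_vertices_imp_zero:
  fixes w :: "'a::euclidean_space"
  assumes "\<alpha> > 0" "\<beta> \<ge> 0"
    and B: "finite B" and orth: "\<And>b. b \<in> B \<Longrightarrow> w \<bullet> vertex \<alpha> \<beta> B b = 0"
    and "b \<in> B"
  shows "w \<bullet> b = 0"
proof -
  have eq: "\<alpha> * (w \<bullet> b) + \<beta> * (w \<bullet> \<Sum>B) = 0" if "b \<in> B" for b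
    using orth[OF that] by (simp add: vertex_def inner_add)
  have "(\<alpha> + card B * \<beta>) * (w \<bullet> \<Sum>B) = (\<Sum>b\<in>B. \<alpha> * (w \<bullet> b) + \<beta> * (w \<bullet> \<Sum>B))"
    by (simp add: sum.distrib inner_sum_right sum_distrib_left algebra_simps)
  also have "\<dots> = 0" using eq by simp
  finally have "(\<alpha> + card B * \<beta>) * (w \<bullet> \<Sum>B) = 0" .
  moreover have "\<alpha> + card B * \<beta> > 0" using assms by (simp add: add_pos_nonneg)
  ultimately have "w \<bullet> \<Sum>B = 0" by simp
  then show ?thesis using eq[OF \<open>b \<in> B\<close>] \<open>\<alpha> > 0\<close> by simp
qed

lemma exists_prime_integral_point_set:
  fixes n d :: nat
  assumes dim: "DIM('a::euclidean_space) \<ge> 3" and n: "n \<ge> DIM('a) + 1" and d: "d \<ge> 1"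
  shows "\<exists>M :: 'a set. prime_integral_point_set M \<and> card M = n \<and>
           (\<exists>x\<in>M. \<exists>y\<in>M. dist x y = real d)"
proof -
  obtain e :: 'a where e: "e \<in> Basis" using nonempty_Basis by blast
  define B where "B = (Basis :: 'a set) - {e}"
  have B: "finite B" "B \<subseteq> Basis" "B \<subseteq> Basis - {e}" "e \<notin> B"
    and card_B: "card B = DIM('a) - 1"
    using e by (auto simp: B_def)
  \<comment> \<open>Dimension at least 3 leaves at least two simplex vertices, and these realise the
    distance \<open>d\<close>.\<close>
  obtain b c where bc: "b \<in> B" "c \<in> B" "b \<noteq> c"
    using card_le_Suc0_iff_eq[OF B(1)] card_B dim by force

  \<comment> \<open>Besides the \<open>DIM('a) - 1\<close> vertices, \<open>q + 1\<close> axis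
    points are needed. Here \<open>q \<ge> 1\<close>, so \<open>0\<close> lies in \<open>I\<close>;
    \<open>K \<ge> q\<close> keeps \<open>K\<close> apart from the other indices, and
    \<open>K \<ge> d\<close> makes the radius \<open>3 ^ K\<close> exceed \<open>d\<close>. The
    indices \<open>0\<close> and \<open>K\<close> serve the gcd, the others only fill up the
    count.\<close>
  define q where "q = n - DIM('a)"
  define K where "K = q + d"
  define I where "I = insert K {..<q}"
  have I: "finite I" "I \<subseteq> {..K}" "0 \<in> I" "K \<in> I" and card_I: "card I = q + 1"
    using n by (auto simp: I_def K_def q_def)

  define \<alpha> where "\<alpha> = real d / sqrt 2"
  have \<alpha>: "\<alpha> > 0" "\<alpha> * sqrt 2 = d" using d by (auto simp: \<alpha>_def)
  have "\<alpha> \<le> real d" using d by (simp add: \<alpha>_def field_simps)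
  also have "real d \<le> 3 ^ K"
  proof -
    have "d < 3 ^ d" by (rule power_gt_expt) simp
    also have "(3::nat) ^ d \<le> 3 ^ K" by (simp add: K_def)
    finally show ?thesis by (metis less_imp_le of_nat_le_iff of_nat_numeral of_nat_power)
  qed
  finally have "\<alpha> \<le> 3 ^ K" .
  moreover have "real (card B) > 0" using card_B dim by simp
  ultimately obtain \<beta> where \<beta>: "\<beta> \<ge> 0" "\<alpha>\<^sup>2 + 2 * \<alpha> * \<beta> + real (card B) * \<beta>\<^sup>2 = (3 ^ K)\<^sup>2"
    using exists_scaled_diagonal[of \<alpha> "3 ^ K" "card B"] \<alpha> by (metis less_imp_le)

  define P where "P = vertex \<alpha> \<beta> B"
  define A where "A i = leg K i *\<^sub>R e" for i
  have PP: "dist (P b) (P c) = d" if "b \<in> B" "c \<in> B" "b \<noteq> c" for b c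
    using dist_vertex_vertex[of b c \<alpha> \<beta> B] that B \<alpha> by (auto simp: P_def)
  have AP: "dist (A i) (P b) = hypot K i" if "i \<in> I" "b \<in> B" for i b
  proof -
    have "(dist (A i) (P b))\<^sup>2 = (real (hypot K i))\<^sup>2"
      using dist_axis_vertex[OF e B(3) that(2)] norm_vertex[OF B(2) that(2)] \<beta>
        leg_pythagoras[of i K] I that by (auto simp: A_def P_def)
    then show ?thesis by simp
  qed
  have AA: "dist (A i) (A j) = \<bar>leg K i - leg K j\<bar>" for i j
    using e by (simp add: A_def dist_norm flip: scaleR_diff_left)
  have hypot_pos: "hypot K i > 0" for i
  proof -
    have "0 < real (hypot K i)" unfolding real_hypot by (simp add: add_pos_pos)
    then show ?thesis by simp
  qed

  define M where "M = A ` I \<union> P ` B"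
  have M: "A i \<in> M" "P b \<in> M" if "i \<in> I" "b \<in> B" for i b using that by (auto simp: M_def)

  have "inj_on A I"
    using inj_on_subset[OF inj_on_leg I(2)] e by (auto simp: A_def inj_on_def)
  moreover have "inj_on P B"
    using PP d by (metis inj_onI dist_self of_nat_0_eq_iff not_one_le_zero)
  moreover have AP_ne: "A i \<noteq> P b" if "i \<in> I" "b \<in> B" for i b
    using AP[OF that] hypot_pos[of i] by auto
  then have "A ` I \<inter> P ` B = {}" by auto
  ultimately have "card M = card I + card B"
    unfolding M_def by (simp add: card_Un_disjoint card_image I B)
  then have "card M = n" using card_I card_B dim n by (simp add: q_def)

  have ints: "dist x y \<in> \<int>" if "x \<in> M" "y \<in> M" for x y
  proof -
    have "dist (P b) (P c) \<in> \<int>" if "b \<in> B" "c \<in> B" for b c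
      using PP[OF that] by (cases "b = c") auto
    moreover have "dist (A i) (P b) \<in> \<int>" "dist (P b) (A i) \<in> \<int>" if "i \<in> I" "b \<in> B" for i b
      using AP[OF that] by (auto simp: dist_commute)
    moreover have "dist (A i) (A j) \<in> \<int>" for i j
      unfolding AA by (intro Ints_abs Ints_diff leg_in_Ints)
    ultimately show ?thesis using that unfolding M_def by auto
  qed

  have full: "\<not> M \<subseteq> H" if H: "affine H" "aff_dim H = int DIM('a) - 1" for H
  proof
    assume "M \<subseteq> H"
    obtain w v where w: "w \<noteq> 0" and "affine hull H = {x. w \<bullet> x = v}"
      using H(2) aff_dim_eq_hyperplane[of H] by auto
    then have H_eq: "H = {x. w \<bullet> x = v}" using H(1) by (metis affine_hull_eq)
    have wM: "w \<bullet> x = v" if "x \<in> M" for x using that \<open>M \<subseteq> H\<close> H_eq by auto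
    \<comment> \<open>\<open>A K\<close> is the origin because \<open>leg K K = 0\<close>, so the
      hyperplane is linear. Its normal \<open>w\<close> is then orthogonal to \<open>A 0\<close>, a
      nonzero multiple of \<open>e\<close>, and to all vertices, hence to the whole basis.\<close>
    have "v = 0" using wM[of "A K"] M(1)[OF I(4) bc(1)] by (simp add: A_def)
    have "leg K K < leg K 0" using d by (intro leg_strict_antimono) (auto simp: K_def)
    then have "w \<bullet> e = 0"
      using wM[of "A 0"] M(1)[OF I(3) bc(1)] \<open>v = 0\<close> by (auto simp: A_def)
    moreover have "w \<bullet> b = 0" if "b \<in> B" for b
      using orthogonal_to_vertices_imp_zero[of \<alpha> \<beta> B w b] \<alpha> \<beta> B wM M(2)[OF I(4)] \<open>v = 0\<close> that
      by (auto simp: P_def)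
    ultimately have "w \<bullet> b = 0" if "b \<in> Basis" for b using that by (auto simp: B_def)
    then show False using w euclidean_all_zero_iff[of w] by blast
  qed

  have "finite M" by (simp add: M_def I B)
  then have "integral_point_set M" using ints full by (auto simp: integral_point_set_def)
  moreover have "Gcd {k::nat. real k \<in> distances M} = 1"
  proof -
    \<comment> \<open>One vertex suffices: its distances to \<open>A K\<close> and
      \<open>A 0\<close> are already coprime.\<close>
    have "hypot K i \<in> {k. real k \<in> distances M}" if "i \<in> I" for i
      using AP[OF that bc(1)] AP_ne[OF that bc(1)] M[OF that bc(1)]
      unfolding distances_def mem_Collect_eq by metis
    then have "Gcd {k. real k \<in> distances M} dvd hypot K K"
      "Gcd {k. real k \<in> distances M} dvd hypot K 0"
      using I by (auto intro!: Gcd_dvd)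
    then show ?thesis using coprime_hypot[of K] by (auto dest: coprime_common_divisor)
  qed
  ultimately have "prime_integral_point_set M" by (simp add: prime_integral_point_set_def)
  moreover have "P b \<in> M" "P c \<in> M" using M I bc by auto
  ultimately show ?thesis using \<open>card M = n\<close> PP[OF bc] by blast
qed

theorem theorem7:
  fixes n d :: nat
  assumes "CARD('m::finite) \<ge> 3"
    and "n \<ge> CARD('m) + 1"
    and "d \<ge> 1"
  shows "\<exists>M :: (real ^ 'm) set. prime_integral_point_set M \<and> card M = n \<and>
           (\<exists>M\<^sub>1\<in>M. \<exists>M\<^sub>2\<in>M. dist M\<^sub>1 M\<^sub>2 = real d)"
  using exists_prime_integral_point_set[where 'a = "real ^ 'm", of n d] assms by simp

end
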